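(* Let $G=(V,E)$ be a graph and let $p\in\mathcal{P}(G)$. Let $X$ be the set of all pairs $(r,\varepsilon)$, with $r$ a reset vector and $\varepsilon\in(0,1)$, such that $p=\mathrm{PR}(G,r,\varepsilon)$. If $pM=p$, then $X=\{(p,\varepsilon):\varepsilon\in(0,1)\}$; otherwise $X=\{(\mathcal{R}^{-1}(G,p,\varepsilon),\varepsilon):\varepsilon\in(0,1),\ \mathcal{R}^{-1}(G,p,\varepsilon)\ge \mathbf{0}\}$.
   Context: Graphs are finite directed graphs; vertices with no out-edges carry a self-loop; $N_{in}(v)$ is the set of in-neighbours and $d_{out}(w)$ the out-degree. $M$ is the matrix with $M[u,v]=1/d_{out}(u)$ if $(u,v)\in E$ and $0$ otherwise; vectors are row vectors. A ranking (reset) vector is $x:V\to[0,1]$ with $\sum_v x[v]=1$. $\mathrm{PR}(G,r,\varepsilon)$ is the unique stationary distribution of the chain with transition matrix $(1-\varepsilon)M+\varepsilon R$, $R[u,v]=r[v]$. $\mathcal{P}(G)=\{\mathrm{PR}(G,r,\varepsilon): r \text{ a ranking vector},\ \varepsilon\in(0,1)\}$. For a ranking vector $p$ and $\varepsilon\in(0,1)$, $\mathcal{R}^{-1}(G,p,\varepsilon)[v]=\frac{p[v]}{\varepsilon}-\frac{1-\varepsilon}{\varepsilon}\sum_{w\in N_{in}(v)}\frac{p[w]}{d_{out}(w)}$. *)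

theory Defs
  imports "HOL-Analysis.Analysis"
begin

text \<open>
  A graph is an edge relation \<open>E\<close> on a finite vertex type \<open>'v\<close>, so the vertex set is all of \<open>'v\<close>.
  The convention that vertices without out-edges carry a self-loop becomes: every vertex has an
  out-edge in \<open>E\<close> (possibly the self-loop).
\<close>

definition digraph :: "('v::finite \<times> 'v) set \<Rightarrow> bool" where
  "digraph E \<longleftrightarrow> (\<forall>u. \<exists>v. (u, v) \<in> E)"

definition N_in :: "('v::finite \<times> 'v) set \<Rightarrow> 'v \<Rightarrow> 'v set" where
  "N_in E v = {w. (w, v) \<in> E}"

definition d_out :: "('v::finite \<times> 'v) set \<Rightarrow> 'v \<Rightarrow> nat" where
  "d_out E u = card {v. (u, v) \<in> E}"

definition walk_matrix :: "('v::finite \<times> 'v) set \<Rightarrow> real ^ 'v ^ 'v" where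
  "walk_matrix E = (\<chi> u v. if (u, v) \<in> E then 1 / real (d_out E u) else 0)"

definition ranking_vector :: "real ^ 'v::finite \<Rightarrow> bool" where
  "ranking_vector x \<longleftrightarrow> (\<forall>v. 0 \<le> x $ v \<and> x $ v \<le> 1) \<and> (\<Sum>v\<in>UNIV. x $ v) = 1"

definition reset_matrix :: "real ^ 'v::finite \<Rightarrow> real ^ 'v ^ 'v" where
  "reset_matrix r = (\<chi> u v. r $ v)"

definition transition_matrix ::
    "('v::finite \<times> 'v) set \<Rightarrow> real ^ 'v \<Rightarrow> real \<Rightarrow> real ^ 'v ^ 'v" where
  "transition_matrix E r \<epsilon> = (1 - \<epsilon>) *\<^sub>R walk_matrix E + \<epsilon> *\<^sub>R reset_matrix r"

definition stationary_distribution :: "real ^ 'v ^ 'v \<Rightarrow> real ^ 'v::finite \<Rightarrow> bool" where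
  "stationary_distribution T x \<longleftrightarrow> ranking_vector x \<and> x v* T = x"

definition PR :: "('v::finite \<times> 'v) set \<Rightarrow> real ^ 'v \<Rightarrow> real \<Rightarrow> real ^ 'v" where
  "PR E r \<epsilon> = (THE x. stationary_distribution (transition_matrix E r \<epsilon>) x)"

definition PageRanks :: "('v::finite \<times> 'v) set \<Rightarrow> (real ^ 'v) set" where
  "PageRanks E = {PR E r \<epsilon> | r \<epsilon>. ranking_vector r \<and> \<epsilon> \<in> {0<..<1}}"

definition R_inv :: "('v::finite \<times> 'v) set \<Rightarrow> real ^ 'v \<Rightarrow> real \<Rightarrow> real ^ 'v" where
  "R_inv E p \<epsilon> = (\<chi> v. p $ v / \<epsilon> - (1 - \<epsilon>) / \<epsilon> * (\<Sum>w\<in>N_in E v. p $ w / real (d_out E w)))"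

end

theory Submission
  imports Defs
begin

text \<open>
  A ranking vector \<open>x\<close> is stationary for the chain with reset vector \<open>r\<close> iff
  \<open>x = (1 - \<epsilon>) x M + \<epsilon> r\<close>. The right-hand side maps the probability simplex into itself, so Brouwer
  gives a solution, and it contracts the \<open>l\<^sub>1\<close> distance by \<open>1 - \<epsilon>\<close> because \<open>M\<close> is stochastic, so the
  solution is unique. Solving the same equation for \<open>r\<close> instead of \<open>x\<close> gives \<open>r = R_inv E p \<epsilon>\<close>, whose
  entries sum to 1 automatically and which equals \<open>p\<close> if \<open>p M = p\<close>.
\<close>

text \<open>A nonnegative entry is at most the total of all entries, which gives the upper bound
  1.\<close>

lemma ranking_vectorI:
  assumes "\<And>v. 0 \<le> x $ v" and "(\<Sum>v\<in>UNIV. x $ v) = 1"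
  shows "ranking_vector x"
proof -
  have "x $ v \<le> 1" for v
    using member_le_sum[of v UNIV "($) x"] assms by simp
  then show ?thesis
    using assms by (simp add: ranking_vector_def)
qed

lemma ranking_vector_sum: "ranking_vector x \<Longrightarrow> (\<Sum>v\<in>UNIV. x $ v) = 1"
  by (simp add: ranking_vector_def)

lemma ranking_vector_nonneg: "ranking_vector x \<Longrightarrow> 0 \<le> x $ v"
  by (simp add: ranking_vector_def)

lemma ranking_vector_axis: "ranking_vector (axis u 1)"
  by (rule ranking_vectorI) (simp_all add: axis_def)

lemma convex_ranking_vectors: "convex {x :: real ^ 'v::finite. ranking_vector x}"
proof (rule convexI)
  fix x y :: "real ^ 'v" and a b :: real
  assume xy: "x \<in> {x. ranking_vector x}" "y \<in> {x. ranking_vector x}"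
    and ab: "0 \<le> a" "0 \<le> b" "a + b = 1"
  have "ranking_vector (a *\<^sub>R x + b *\<^sub>R y)"
  proof (rule ranking_vectorI)
    show "0 \<le> (a *\<^sub>R x + b *\<^sub>R y) $ v" for v
      using xy ab by (simp add: ranking_vector_nonneg)
    show "(\<Sum>v\<in>UNIV. (a *\<^sub>R x + b *\<^sub>R y) $ v) = 1"
      using xy ab by (simp add: sum.distrib ranking_vector_sum flip: sum_distrib_left)
  qed
  then show "a *\<^sub>R x + b *\<^sub>R y \<in> {x. ranking_vector x}" by simp
qed

lemma compact_ranking_vectors: "compact {x :: real ^ 'v::finite. ranking_vector x}"
proof -
  have "{x :: real ^ 'v. ranking_vector x} =
      cbox 0 (\<chi> v. 1) \<inter> {x. (\<Sum>v\<in>UNIV. x $ v) = 1}"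
    by (auto simp: ranking_vector_def mem_box_cart)
  moreover have "closed {x :: real ^ 'v. (\<Sum>v\<in>UNIV. x $ v) = 1}"
    by (intro closed_Collect_eq continuous_intros)
  ultimately show ?thesis
    by (simp add: compact_Int_closed)
qed

lemma walk_matrix_nonneg: "0 \<le> walk_matrix E $ u $ v"
  by (simp add: walk_matrix_def)

lemma walk_matrix_row_sum:
  assumes "digraph E"
  shows "(\<Sum>v\<in>UNIV. walk_matrix E $ u $ v) = 1"
proof -
  have "{v. (u, v) \<in> E} \<noteq> {}"
    using assms by (auto simp: digraph_def)
  \<comment> \<open>This makes \<open>1 / real (d_out E u)\<close> a true reciprocal rather than the
    default value 0 of division by zero.\<close>
  then have "d_out E u \<noteq> 0"
    by (simp add: d_out_def)
  moreover have "(\<Sum>v\<in>UNIV. walk_matrix E $ u $ v) = (\<Sum>v | (u, v) \<in> E. 1 / real (d_out E u))"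
    by (simp add: walk_matrix_def sum.If_cases)
  ultimately show ?thesis
    by (simp add: d_out_def)
qed

text \<open>Links the matrix product to the sum over in-neighbours that occurs in
  \<open>R_inv\<close>.\<close>

lemma vector_walk_matrix_nth:
  "(x v* walk_matrix E) $ v = (\<Sum>w\<in>N_in E v. x $ w / real (d_out E w))"
  unfolding vector_matrix_mult_def walk_matrix_def N_in_def
  by (simp add: if_distrib[of "\<lambda>a. _ * a"] sum.If_cases cong: if_cong)

text \<open>Swapping the two sums leaves the row sums of the walk matrix, which are all 1.\<close>

lemma sum_vector_walk_matrix:
  assumes "digraph E"
  shows "(\<Sum>v\<in>UNIV. (x v* walk_matrix E) $ v) = (\<Sum>v\<in>UNIV. x $ v)"
proof -
  have "(\<Sum>v\<in>UNIV. (x v* walk_matrix E) $ v)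
      = (\<Sum>u\<in>UNIV. x $ u * (\<Sum>v\<in>UNIV. walk_matrix E $ u $ v))"
    unfolding vector_matrix_mult_def by (simp add: sum_distrib_left) (rule sum.swap)
  then show ?thesis
    by (simp add: walk_matrix_row_sum[OF assms])
qed

text \<open>By the triangle inequality, each entry of the image of \<open>x\<close> is bounded by
  that of the image of its entrywise absolute value, and the walk matrix preserves the total of the
  latter.\<close>

lemma sum_abs_vector_walk_matrix_le:
  assumes "digraph E"
  shows "(\<Sum>v\<in>UNIV. \<bar>(x v* walk_matrix E) $ v\<bar>) \<le> (\<Sum>v\<in>UNIV. \<bar>x $ v\<bar>)"
proof -
  have "(\<Sum>v\<in>UNIV. \<bar>(x v* walk_matrix E) $ v\<bar>)
      \<le> (\<Sum>v\<in>UNIV. ((\<chi> u. \<bar>x $ u\<bar>) v* walk_matrix E) $ v)"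
    unfolding vector_matrix_mult_def
    by (intro sum_mono)
      (auto intro!: order_trans[OF sum_abs] sum_mono simp: abs_mult walk_matrix_nonneg)
  then show ?thesis
    by (simp add: sum_vector_walk_matrix[OF assms])
qed

lemma ranking_vector_walk_matrix:
  assumes "digraph E" and "ranking_vector x"
  shows "ranking_vector (x v* walk_matrix E)"
proof (rule ranking_vectorI)
  show "0 \<le> (x v* walk_matrix E) $ v" for v
    using assms by (auto simp: vector_walk_matrix_nth ranking_vector_nonneg intro!: sum_nonneg)
qed (use assms in \<open>simp add: sum_vector_walk_matrix ranking_vector_sum\<close>)

text \<open>Every row of the reset matrix is \<open>r\<close>, so it sends \<open>x\<close> to
  \<open>r\<close> times the entry sum of \<open>x\<close>, which is 1.\<close>

lemma vector_transition_matrix: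
  assumes "ranking_vector x"
  shows "x v* transition_matrix E r \<epsilon> = (1 - \<epsilon>) *\<^sub>R (x v* walk_matrix E) + \<epsilon> *\<^sub>R r"
proof -
  have "(x v* transition_matrix E r \<epsilon>) $ v = ((1 - \<epsilon>) *\<^sub>R (x v* walk_matrix E) + \<epsilon> *\<^sub>R r) $ v" for v
  proof -
    have "(x v* transition_matrix E r \<epsilon>) $ v
        = (1 - \<epsilon>) * (x v* walk_matrix E) $ v + \<epsilon> * r $ v * (\<Sum>u\<in>UNIV. x $ u)"
      unfolding vector_matrix_mult_def transition_matrix_def reset_matrix_def
      by (simp add: sum_distrib_left sum.distrib distrib_left ac_simps)
    then show ?thesis
      using assms by (simp add: ranking_vector_sum)
  qed
  then show ?thesis by (simp add: vec_eq_iff)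
qed

lemma stationary_distribution_exists:
  assumes "digraph E" and "ranking_vector r" and "\<epsilon> \<in> {0<..<1}"
  shows "\<exists>x. stationary_distribution (transition_matrix E r \<epsilon>) x"
proof -
  define f where "f x = (1 - \<epsilon>) *\<^sub>R (x v* walk_matrix E) + \<epsilon> *\<^sub>R r" for x
  have "continuous_on {x. ranking_vector x} f"
    unfolding f_def vector_matrix_mult_def by (intro continuous_intros)
  moreover have "f ` {x. ranking_vector x} \<subseteq> {x. ranking_vector x}"
  proof (rule image_subsetI)
    fix x :: "real ^ 'a" assume "x \<in> {x. ranking_vector x}"
    \<comment> \<open>\<open>f x\<close> is the convex combination, with weights
      \<open>1 - \<epsilon>\<close> and \<open>\<epsilon>\<close>, of the ranking vectors
      \<open>x v* walk_matrix E\<close> and \<open>r\<close>.\<close>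
    then show "f x \<in> {x. ranking_vector x}"
      unfolding f_def using assms ranking_vector_walk_matrix[OF assms(1), of x]
      by (intro convexD[OF convex_ranking_vectors]) auto
  qed
  moreover have "{x :: real ^ 'a. ranking_vector x} \<noteq> {}"
    using ranking_vector_axis by blast
  ultimately obtain x where "ranking_vector x" "f x = x"
    using brouwer[OF compact_ranking_vectors convex_ranking_vectors, of f]
    by (auto simp: image_subset_iff_funcset)
  then show ?thesis
    unfolding stationary_distribution_def f_def by (metis vector_transition_matrix)
qed

lemma stationary_distribution_unique:
  assumes "digraph E" and "\<epsilon> \<in> {0<..<1}"
    and x: "stationary_distribution (transition_matrix E r \<epsilon>) x"
    and y: "stationary_distribution (transition_matrix E r \<epsilon>) y"
  shows "x = y"
proof -
  define S where "S = (\<Sum>v\<in>UNIV. \<bar>(x - y) $ v\<bar>)"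
  have "x = (1 - \<epsilon>) *\<^sub>R (x v* walk_matrix E) + \<epsilon> *\<^sub>R r"
    "y = (1 - \<epsilon>) *\<^sub>R (y v* walk_matrix E) + \<epsilon> *\<^sub>R r"
    using x y unfolding stationary_distribution_def by (metis vector_transition_matrix)+
  \<comment> \<open>The reset term is the same in both equations and cancels.\<close>
  then have "x - y = (1 - \<epsilon>) *\<^sub>R (x v* walk_matrix E - y v* walk_matrix E)"
    by (metis add_diff_cancel_right scaleR_diff_right)
  also have "x v* walk_matrix E - y v* walk_matrix E = (x - y) v* walk_matrix E"
    by (simp add: vector_matrix_mult_diff_distrib)
  finally have "S = (\<Sum>v\<in>UNIV. \<bar>((1 - \<epsilon>) *\<^sub>R ((x - y) v* walk_matrix E)) $ v\<bar>)"
    unfolding S_def by simp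
  also have "\<dots> = (1 - \<epsilon>) * (\<Sum>v\<in>UNIV. \<bar>((x - y) v* walk_matrix E) $ v\<bar>)"
    using assms(2) by (simp add: abs_mult sum_distrib_left)
  also have "\<dots> \<le> (1 - \<epsilon>) * S"
    unfolding S_def using assms(2)
    by (intro mult_left_mono sum_abs_vector_walk_matrix_le[OF assms(1)]) auto
  finally have "\<epsilon> * S \<le> 0"
    by (simp add: algebra_simps)
  then have "S \<le> 0"
    using assms(2) by (simp add: mult_le_0_iff)
  moreover have "S \<ge> 0"
    unfolding S_def by (simp add: sum_nonneg)
  ultimately have "S = 0"
    by simp
  then show ?thesis
    by (simp add: S_def sum_nonneg_eq_0_iff vec_eq_iff)
qed

text \<open>Existence and uniqueness make the definite description in \<open>PR\<close> meaningful,
  so that it can be replaced by the stationarity condition.\<close>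

lemma PR_eq_iff:
  assumes "digraph E" and "ranking_vector r" and "\<epsilon> \<in> {0<..<1}"
  shows "p = PR E r \<epsilon> \<longleftrightarrow> stationary_distribution (transition_matrix E r \<epsilon>) p"
proof -
  have "\<exists>!x. stationary_distribution (transition_matrix E r \<epsilon>) x"
    using stationary_distribution_exists[OF assms] stationary_distribution_unique[OF assms(1,3)]
    by blast
  then show ?thesis
    unfolding PR_def by (metis (no_types, lifting) the1_equality theI')
qed

lemma PageRanks_ranking_vector:
  assumes "digraph E" and "p \<in> PageRanks E"
  shows "ranking_vector p"
  using assms PR_eq_iff[OF assms(1)]
  by (auto simp: PageRanks_def stationary_distribution_def)

lemma R_inv_nth:
  "R_inv E p \<epsilon> $ v = p $ v / \<epsilon> - (1 - \<epsilon>) / \<epsilon> * (p v* walk_matrix E) $ v"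
  by (simp add: R_inv_def vector_walk_matrix_nth)

text \<open>In each coordinate, stationarity is an affine equation in which the entry of
  \<open>r\<close> has coefficient \<open>\<epsilon>\<close>, so it can be solved for that
  entry.\<close>

lemma stationary_distribution_iff_R_inv:
  assumes "ranking_vector p" and "\<epsilon> \<noteq> 0"
  shows "stationary_distribution (transition_matrix E r \<epsilon>) p \<longleftrightarrow> r = R_inv E p \<epsilon>"
proof -
  have "((1 - \<epsilon>) * a + \<epsilon> * b = c) = (b = c / \<epsilon> - (1 - \<epsilon>) / \<epsilon> * a)" for a b c :: real
    using assms(2) by (auto simp: field_simps)
  then show ?thesis
    using assms
    by (simp add: stationary_distribution_def vector_transition_matrix vec_eq_iff R_inv_nth)
qed

text \<open>Both \<open>p\<close> and its image under the walk matrix have entry sum 1, which leaves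
  \<open>1 / \<epsilon> - (1 - \<epsilon>) / \<epsilon> = 1\<close>.\<close>

lemma R_inv_sum:
  assumes "digraph E" and "ranking_vector p" and "\<epsilon> \<noteq> 0"
  shows "(\<Sum>v\<in>UNIV. R_inv E p \<epsilon> $ v) = 1"
proof -
  have "(\<Sum>v\<in>UNIV. R_inv E p \<epsilon> $ v)
      = (\<Sum>v\<in>UNIV. p $ v) / \<epsilon> - (1 - \<epsilon>) / \<epsilon> * (\<Sum>v\<in>UNIV. (p v* walk_matrix E) $ v)"
    by (simp add: R_inv_nth sum_subtractf sum_divide_distrib sum_distrib_left)
  also have "\<dots> = 1"
    using assms by (simp add: sum_vector_walk_matrix ranking_vector_sum field_simps)
  finally show ?thesis .
qed

lemma R_inv_stationary:
  assumes "p v* walk_matrix E = p" and "\<epsilon> \<noteq> 0"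
  shows "R_inv E p \<epsilon> = p"
  using assms by (simp add: vec_eq_iff R_inv_nth field_simps)

theorem theorem17:
  fixes E :: "('v::finite \<times> 'v) set" and p :: "real ^ 'v" and X :: "((real ^ 'v) \<times> real) set"
  assumes "digraph E"
    and "p \<in> PageRanks E"
    and "X = {(r, \<epsilon>). ranking_vector r \<and> \<epsilon> \<in> {0<..<1} \<and> p = PR E r \<epsilon>}"
  shows "(p v* walk_matrix E = p \<longrightarrow> X = {(p, \<epsilon>) | \<epsilon>. \<epsilon> \<in> {0<..<1}})
    \<and> (p v* walk_matrix E \<noteq> p \<longrightarrow>
         X = {(R_inv E p \<epsilon>, \<epsilon>) | \<epsilon>. \<epsilon> \<in> {0<..<1} \<and> (\<forall>v. R_inv E p \<epsilon> $ v \<ge> 0)})"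
proof -
  have p: "ranking_vector p"
    using assms(1,2) by (rule PageRanks_ranking_vector)
  \<comment> \<open>The entries already sum to 1, so only their signs decide.\<close>
  have ranking: "ranking_vector (R_inv E p \<epsilon>) \<longleftrightarrow> (\<forall>v. R_inv E p \<epsilon> $ v \<ge> 0)"
    if "\<epsilon> \<in> {0<..<1}" for \<epsilon>
    using that R_inv_sum[OF assms(1) p] ranking_vectorI[of "R_inv E p \<epsilon>"]
    by (auto simp: ranking_vector_nonneg)
  \<comment> \<open>Each \<open>\<epsilon>\<close> admits a single candidate for \<open>r\<close>,
    and it is accepted exactly when it is nonnegative.\<close>
  have "(r, \<epsilon>) \<in> X \<longleftrightarrow> \<epsilon> \<in> {0<..<1} \<and> r = R_inv E p \<epsilon> \<and> (\<forall>v. R_inv E p \<epsilon> $ v \<ge> 0)" for r \<epsilon>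
  proof (cases "\<epsilon> \<in> {0<..<1}")
    case True
    then have "p = PR E r \<epsilon> \<longleftrightarrow> r = R_inv E p \<epsilon>" if "ranking_vector r"
      using PR_eq_iff[OF assms(1) that True] stationary_distribution_iff_R_inv[OF p] by simp
    then show ?thesis
      using True ranking[OF True] by (auto simp: assms(3))
  qed (auto simp: assms(3))
  then have X: "X = {(R_inv E p \<epsilon>, \<epsilon>) | \<epsilon>. \<epsilon> \<in> {0<..<1} \<and> (\<forall>v. R_inv E p \<epsilon> $ v \<ge> 0)}"
    by (auto simp del: greaterThanLessThan_iff)
  \<comment> \<open>The description of \<open>X\<close> just obtained covers both cases. Here the
    candidate is \<open>p\<close> itself, which is nonnegative, so every \<open>\<epsilon>\<close>
    is accepted.\<close>
  moreover have "X = {(p, \<epsilon>) | \<epsilon>. \<epsilon> \<in> {0<..<1}}" if "p v* walk_matrix E = p"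
    unfolding X using R_inv_stationary[OF that] ranking_vector_nonneg[OF p] by force
  ultimately show ?thesis by blast
qed

end
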